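(* Pair-sum resonance can preserve nonflat minimal geometry under genuinely nonuniform diagonal dilations, in the following sense. (1) In $\mathbb R^3$, let $g_1=g_2=1$ and $g_3=\gamma>0$ with $\gamma\ne1$, let $D_t=\operatorname{diag}(t^{g_1},t^{g_2},t^{g_3})$, and for $c\ne0$ set $$\Sigma_c=\{(x_1,x_2,x_3)\in\mathbb R^3: x_1>0,\ x_2>0,\ x_3=c\arctan(x_2/x_1)\}.$$ Then for every $t>0$ the image $D_t\Sigma_c$ is again a helicoid patch and hence minimal, while $\Sigma_c$ is nonflat. (2) In $\mathbb R^4$, let $(g_1,g_2,g_3,g_4)=(1,2,3,4)$, let $D_t=\operatorname{diag}(t,t^2,t^3,t^4)$, and let $$\Sigma=\{x\in\mathbb R^4: x_1x_4+x_2x_3=0\}.$$ Then the regular part of $\Sigma$ is $\Sigma\setminus\{0\}$; this regular part is connected, nonflat and minimal, and $D_t(\Sigma\setminus\{0\})=\Sigma\setminus\{0\}$ for every $t>0$.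
   Context: Weights $g_1,\ldots,g_n>0$ are pair-sum nonresonant if all sums $g_i+g_j$ with $i<j$ are distinct, and resonant otherwise; the family $D_t$ is nonuniform if the weights are not all equal. A $C^2$ hypersurface is minimal if its Euclidean mean-curvature vector vanishes identically, and nonflat if its second fundamental form is not identically zero. A helicoid patch is a nonempty open piece of a helicoid in $\mathbb R^3$, i.e. of a surface $\{(u\cos v,u\sin v,c'v):u,v\in\mathbb R\}$ with $c'\ne0$, up to rigid motion. The regular part of the zero set of $F=x_1x_4+x_2x_3$ is the set of its points where $\nabla F\ne0$. *)

theory Defs
  imports "HOL-Analysis.Analysis"
begin

section \<open>Hypersurfaces of Euclidean space\<close>

definition C1_on :: "'a::real_normed_vector set \<Rightarrow> ('a \<Rightarrow> 'b::real_normed_vector) \<Rightarrow> bool" where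
  "C1_on U f \<longleftrightarrow> (\<exists>f' :: 'a \<Rightarrow> 'a \<Rightarrow>\<^sub>L 'b.
     (\<forall>x\<in>U. (f has_derivative blinfun_apply (f' x)) (at x)) \<and> continuous_on U f')"

text \<open>Locally a level set of a \<open>C\<^sup>2\<close> function with nowhere vanishing gradient \<open>G\<close>;
  \<open>f\<close> is \<open>C\<^sup>2\<close> exactly when its gradient is \<open>C\<^sup>1\<close>.\<close>

definition C2_hypersurface :: "'a::euclidean_space set \<Rightarrow> bool" where
  "C2_hypersurface S \<longleftrightarrow> (\<forall>p\<in>S. \<exists>U (f :: 'a \<Rightarrow> real) G. open U \<and> p \<in> U \<and>
     (\<forall>x\<in>U. GDERIV f x :> G x \<and> G x \<noteq> 0) \<and> C1_on U G \<and> S \<inter> U = {x \<in> U. f x = 0})"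

definition tangent_space :: "'a::euclidean_space set \<Rightarrow> 'a \<Rightarrow> 'a set" where
  "tangent_space S p = {v. \<exists>\<gamma> \<epsilon>. \<epsilon> > 0 \<and> (\<forall>s\<in>{-\<epsilon><..<\<epsilon>}. \<gamma> s \<in> S) \<and> \<gamma> 0 = p \<and>
     (\<gamma> has_vector_derivative v) (at (0::real))}"

definition unit_normal_field :: "'a::euclidean_space set \<Rightarrow> ('a \<Rightarrow> 'a) \<Rightarrow> bool" where
  "unit_normal_field S N \<longleftrightarrow> N differentiable_on S \<and>
     (\<forall>q\<in>S. norm (N q) = 1 \<and> (\<forall>v\<in>tangent_space S q. N q \<bullet> v = 0))"

text \<open>The vector-valued second fundamental form, \<open>II(u, v) = - \<langle>dN(u), v\<rangle> N\<close> for a unit normal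
  field \<open>N\<close> of \<open>S\<close> near \<open>p\<close>. It does not change when \<open>N\<close> is replaced by \<open>-N\<close>. The derivative
  \<open>N'\<close> of \<open>N\<close> along \<open>S\<close> is determined on tangent vectors only, so the form is meaningful for
  \<open>u, v \<in> tangent_space S p\<close> with \<open>S\<close> a \<open>C\<^sup>2\<close> hypersurface.\<close>

definition second_fundamental_form :: "'a::euclidean_space set \<Rightarrow> 'a \<Rightarrow> 'a \<Rightarrow> 'a \<Rightarrow> 'a" where
  "second_fundamental_form S p u v = (THE w. \<exists>U N N'. open U \<and> p \<in> U \<and>
     unit_normal_field (S \<inter> U) N \<and> (N has_derivative N') (at p within S) \<and>
     w = - (N' u \<bullet> v) *\<^sub>R N p)"

definition orthonormal_basis_of :: "'a::euclidean_space set \<Rightarrow> 'a set \<Rightarrow> bool" where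
  "orthonormal_basis_of V B \<longleftrightarrow> pairwise orthogonal B \<and> (\<forall>e\<in>B. norm e = 1) \<and> span B = V"

text \<open>The trace of the second fundamental form, not divided by the dimension. It does not depend
  on the orthonormal basis chosen.\<close>

definition mean_curvature_vector :: "'a::euclidean_space set \<Rightarrow> 'a \<Rightarrow> 'a" where
  "mean_curvature_vector S p =
     (\<Sum>e\<in>(SOME B. orthonormal_basis_of (tangent_space S p) B). second_fundamental_form S p e e)"

definition minimal_hypersurface :: "'a::euclidean_space set \<Rightarrow> bool" where
  "minimal_hypersurface S \<longleftrightarrow> C2_hypersurface S \<and> (\<forall>p\<in>S. mean_curvature_vector S p = 0)"

definition nonflat_hypersurface :: "'a::euclidean_space set \<Rightarrow> bool" where
  "nonflat_hypersurface S \<longleftrightarrow> C2_hypersurface S \<and>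
     (\<exists>p\<in>S. \<exists>u\<in>tangent_space S p. \<exists>v\<in>tangent_space S p. second_fundamental_form S p u v \<noteq> 0)"

text \<open>A point at which \<open>F\<close> is not differentiable would not be regular.\<close>

definition regular_part :: "('a::euclidean_space \<Rightarrow> real) \<Rightarrow> 'a set" where
  "regular_part F = {x. F x = 0 \<and> (\<exists>G. GDERIV F x :> G \<and> G \<noteq> 0)}"

section \<open>Helicoids\<close>

definition helicoid :: "real \<Rightarrow> (real^3) set" where
  "helicoid c = {vector [u * cos v, u * sin v, c * v] | u v. True}"

text \<open>Improper motions are allowed; as a reflection turns \<open>helicoid c\<close> into \<open>helicoid (- c)\<close>,
  proper motions would give the same patches.\<close>

definition rigid_motion :: "(real^3 \<Rightarrow> real^3) \<Rightarrow> bool" where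
  "rigid_motion R \<longleftrightarrow> (\<exists>a T. orthogonal_transformation T \<and> R = (\<lambda>x. a + T x))"

definition helicoid_patch :: "(real^3) set \<Rightarrow> bool" where
  "helicoid_patch P \<longleftrightarrow> (\<exists>c R. c \<noteq> 0 \<and> rigid_motion R \<and> P \<noteq> {} \<and>
     openin (top_of_set (R ` helicoid c)) P)"

section \<open>Weights and diagonal dilations\<close>

text \<open>The sums \<open>g\<^sub>i + g\<^sub>j\<close> with \<open>i < j\<close> are indexed by the two-element sets of indices.\<close>

definition pair_sum_nonresonant :: "real^'n \<Rightarrow> bool" where
  "pair_sum_nonresonant g \<longleftrightarrow> inj_on (\<lambda>P. \<Sum>i\<in>P. g $ i) {P. card P = 2}"

abbreviation pair_sum_resonant :: "real^'n \<Rightarrow> bool" where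
  "pair_sum_resonant g \<equiv> \<not> pair_sum_nonresonant g"

definition positive_weights :: "real^'n \<Rightarrow> bool" where
  "positive_weights g \<longleftrightarrow> (\<forall>i. g $ i > 0)"

definition nonuniform :: "real^'n \<Rightarrow> bool" where
  "nonuniform g \<longleftrightarrow> (\<exists>i j. g $ i \<noteq> g $ j)"

definition dilation :: "real^'n \<Rightarrow> real \<Rightarrow> real^'n \<Rightarrow> real^'n" where
  "dilation g t x = (\<chi> i. t powr (g $ i) * x $ i)"

section \<open>The two hypersurfaces\<close>

definition arctan_graph :: "real \<Rightarrow> (real^3) set" where
  "arctan_graph c = {x. x $ 1 > 0 \<and> x $ 2 > 0 \<and> x $ 3 = c * arctan (x $ 2 / x $ 1)}"

definition quadric_form :: "real^4 \<Rightarrow> real" where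
  "quadric_form x = x $ 1 * x $ 4 + x $ 2 * x $ 3"

definition quadric_cone :: "(real^4) set" where
  "quadric_cone = {x. quadric_form x = 0}"

end

theory Submission
  imports Defs
begin

text \<open>On the zero set of \<open>f\<close> with gradient \<open>G \<noteq> 0\<close> and Hessian \<open>H\<close>, the second fundamental
  form is \<open>- \<langle>H u, v\<rangle> G / |G|\<^sup>2\<close> on \<open>G\<^sup>\<bottom>\<close>, so the mean curvature vanishes if \<open>tr H = 0\<close> and
  \<open>\<langle>H G, G\<rangle> = 0\<close>. Both hold for \<open>x\<^sub>3 - c arctan (x\<^sub>2 / x\<^sub>1)\<close>, and also for \<open>x\<^sub>1 x\<^sub>4 + x\<^sub>2 x\<^sub>3\<close> on its
  zero set, where \<open>H\<close> is a constant trace-free involution with \<open>G = H x\<close>. The equal weights turn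
  \<open>D\<^sub>t\<close> into the change of pitch \<open>c \<mapsto> t\<^sup>\<gamma> c\<close> in the first family; the equality \<open>1 + 4 = 2 + 3\<close>
  makes the quadratic form homogeneous under \<open>D\<^sub>t\<close>.\<close>

section \<open>Level sets\<close>

text \<open>The chain rule along a curve gives one inclusion. For the other, a curve with velocity
  \<open>v\<close> arises by projecting the line \<open>p + s *\<^sub>R v\<close> onto the zero set:
  the intermediate value theorem in direction \<open>g\<close> shows that the line stays within o(s)
  of it.\<close>

lemma tangent_space_level_set:
  fixes f :: "'a::euclidean_space \<Rightarrow> real"
  assumes "open U" "p \<in> U" "p \<in> S" and level: "S \<inter> U = {x \<in> U. f x = 0}"
    and cont: "continuous_on U f" and grad: "GDERIV f p :> g" and "g \<noteq> 0"
  shows "tangent_space S p = {v. g \<bullet> v = 0}"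
proof (intro set_eqI iffI)
  fix v assume "v \<in> tangent_space S p"
  then obtain \<gamma> \<epsilon> where e: "\<epsilon> > 0" and S: "\<And>s. s \<in> {-\<epsilon><..<\<epsilon>} \<Longrightarrow> \<gamma> s \<in> S" and p: "\<gamma> 0 = p"
    and der: "(\<gamma> has_vector_derivative v) (at (0::real))"
    unfolding tangent_space_def by blast
  have "isCont \<gamma> 0" using der by (rule has_vector_derivative_continuous)
  then have "\<forall>\<^sub>F s in at 0. \<gamma> s \<in> U"
    using assms(1,2) p by (auto simp: isCont_def dest: topological_tendstoD)
  moreover have "\<forall>\<^sub>F s in at 0. s \<in> {-\<epsilon><..<\<epsilon>}"
    using e by (intro eventually_at_in_open') auto
  ultimately have zero: "\<forall>\<^sub>F s in at 0. f (\<gamma> s) = 0"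
    by eventually_elim (use S level in blast)
  have "((f \<circ> \<gamma>) has_derivative (\<lambda>h. h \<bullet> g) \<circ> (\<lambda>s. s *\<^sub>R v)) (at 0)"
    using der grad p by (intro diff_chain_at) (auto simp: gderiv_def has_vector_derivative_def)
  then have "((\<lambda>s. 0) has_derivative (\<lambda>h. h \<bullet> g) \<circ> (\<lambda>s. s *\<^sub>R v)) (at 0)"
    using zero level assms(2,3) p by (elim has_derivative_transform_eventually) auto
  then have "(\<lambda>h. h \<bullet> g) \<circ> (\<lambda>s. s *\<^sub>R v) = (\<lambda>s. 0)"
    by (rule has_derivative_unique) simp
  then have "((\<lambda>h. h \<bullet> g) \<circ> (\<lambda>s. s *\<^sub>R v)) 1 = 0" by simp
  then show "v \<in> {v. g \<bullet> v = 0}" by (simp add: inner_commute)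
next
  fix v assume "v \<in> {v. g \<bullet> v = 0}"
  then have gv: "g \<bullet> v = 0" by simp
  have fp: "f p = 0" using assms(2,3) level by blast
  obtain r where r: "r > 0" "cball p r \<subseteq> U"
    using assms(1,2) open_contains_cball by blast
  \<comment> \<open>Cutting with a closed ball inside \<open>U\<close>, where \<open>f\<close> is
    continuous, makes the zero set closed, so closest points exist.\<close>
  define K where "K = {x \<in> cball p r. f x = 0}"
  have "K \<subseteq> S" using r level by (auto simp: K_def)
  have pK: "p \<in> K" using r fp by (simp add: K_def)
  have "closed K"
  proof -
    have "closed {x \<in> cball p r. f x \<in> {0}}"
      using continuous_on_subset[OF cont r(2)]
      by (intro continuous_closed_preimage[unfolded vimage_def Int_def, simplified mem_Collect_eq]) auto
    then show ?thesis by (simp add: K_def)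
  qed
  \<comment> \<open>The closest points need not depend continuously on \<open>s\<close>, but \<open>tangent_space\<close> only asks for a
    derivative at \<open>0\<close>.\<close>
  define \<gamma> where "\<gamma> s = closest_point K (p + s *\<^sub>R v)" for s
  have \<gamma>0: "\<gamma> 0 = p" using pK by (simp add: \<gamma>_def closest_point_self)
  have \<gamma>S: "\<gamma> s \<in> S" for s
    using closest_point_in_set[OF \<open>closed K\<close>] pK \<open>K \<subseteq> S\<close> by (auto simp: \<gamma>_def)
  \<comment> \<open>An o(s) distance to the line is precisely differentiability of
    \<open>\<gamma>\<close> at \<open>0\<close> with derivative \<open>v\<close>.\<close>
  have near: "\<exists>d>0. \<forall>s. \<bar>s\<bar> < d \<longrightarrow> norm (\<gamma> s - (p + s *\<^sub>R v)) \<le> e * \<bar>s\<bar>" if "e > 0" for e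
  proof -
    \<comment> \<open>Moving by \<open>\<eta> * \<bar>s\<bar>\<close> along \<open>g\<close> covers
      the distance \<open>e * \<bar>s\<bar>\<close>, and points reached this way stay within
      \<open>m * \<bar>s\<bar>\<close> of \<open>p\<close>.\<close>
    define m where "m = norm v + e"
    define \<eta> where "\<eta> = e / norm g"
    have pos: "norm g > 0" "m > 0" "\<eta> > 0"
      using \<open>g \<noteq> 0\<close> \<open>e > 0\<close> by (auto simp: m_def \<eta>_def add_nonneg_pos)
    \<comment> \<open>With this tolerance the linearisation error at distance
      \<open>m * \<bar>s\<bar>\<close> is at most \<open>h * (g \<bullet> g)\<close>, the change of
      the linear part over a step \<open>h\<close> along \<open>g\<close>.\<close>
    have "e * norm g / m > 0" using pos \<open>e > 0\<close> by simp
    then obtain d where d: "d > 0"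
      "\<And>y. norm (y - p) < d \<Longrightarrow> norm (f y - f p - (y - p) \<bullet> g) \<le> e * norm g / m * norm (y - p)"
      using grad unfolding gderiv_def has_derivative_at_alt by meson
    define \<delta> where "\<delta> = min d r / m"
    have "\<delta> > 0" using d r pos by (simp add: \<delta>_def)
    moreover have "norm (\<gamma> s - (p + s *\<^sub>R v)) \<le> e * \<bar>s\<bar>" if s: "\<bar>s\<bar> < \<delta>" for s
    proof -
      define x where "x \<tau> = p + s *\<^sub>R v + \<tau> *\<^sub>R g" for \<tau>
      define h where "h = \<eta> * \<bar>s\<bar>"
      have "h \<ge> 0" using pos by (simp add: h_def)
      have ms: "m * \<bar>s\<bar> < d" "m * \<bar>s\<bar> < r"
        using s pos by (auto simp: \<delta>_def field_simps)
      have dist: "norm (x \<tau> - p) \<le> m * \<bar>s\<bar>" if "\<bar>\<tau>\<bar> \<le> h" for \<tau>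
      proof -
        have "norm (x \<tau> - p) \<le> \<bar>s\<bar> * norm v + \<bar>\<tau>\<bar> * norm g"
          by (simp add: x_def) (metis norm_triangle_ineq norm_scaleR)
        also have "\<bar>\<tau>\<bar> * norm g \<le> h * norm g" using that by (intro mult_right_mono) auto
        also have "h * norm g = e * \<bar>s\<bar>" using pos by (simp add: h_def \<eta>_def)
        finally show ?thesis by (simp add: m_def algebra_simps)
      qed
      have err: "\<bar>f (x \<tau>) - \<tau> * (g \<bullet> g)\<bar> \<le> h * (g \<bullet> g)" if "\<bar>\<tau>\<bar> \<le> h" for \<tau>
      proof -
        have "norm (f (x \<tau>) - f p - (x \<tau> - p) \<bullet> g) \<le> e * norm g / m * norm (x \<tau> - p)"
          using dist[OF that] ms by (intro d) auto
        also have "\<dots> \<le> e * norm g / m * (m * \<bar>s\<bar>)"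
          using dist[OF that] pos \<open>e > 0\<close> by (intro mult_left_mono) auto
        also have "\<dots> = h * (g \<bullet> g)"
          using pos by (simp add: h_def \<eta>_def dot_square_norm power2_eq_square)
        finally show ?thesis
          using gv by (simp add: fp x_def inner_simps inner_commute[of v])
      qed
      \<comment> \<open>At \<open>\<tau> = h\<close> and \<open>\<tau> = -h\<close> the linear part
        \<open>\<tau> * (g \<bullet> g)\<close> is at least as large as the error, which fixes the
        sign of \<open>f\<close>.\<close>
      have "\<exists>\<tau>\<ge>-h. \<tau> \<le> h \<and> f (x \<tau>) = 0"
      proof (rule IVT')
        show "f (x (-h)) \<le> 0" "0 \<le> f (x h)"
          using err[of "-h"] err[of h] \<open>h \<ge> 0\<close> by (auto simp: abs_le_iff)
        have "x ` {-h..h} \<subseteq> cball p r"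
        proof (intro image_subsetI)
          fix \<tau> assume "\<tau> \<in> {-h..h}"
          then have "norm (x \<tau> - p) \<le> r" using dist[of \<tau>] ms by (auto simp: abs_le_iff)
          then show "x \<tau> \<in> cball p r" by (simp add: dist_norm norm_minus_commute)
        qed
        then show "continuous_on {-h..h} (\<lambda>\<tau>. f (x \<tau>))"
          using r by (intro continuous_on_compose2[OF cont]) (auto simp: x_def intro!: continuous_intros)
      qed (use \<open>h \<ge> 0\<close> in auto)
      then obtain \<tau> where \<tau>: "\<bar>\<tau>\<bar> \<le> h" "f (x \<tau>) = 0" by (metis abs_le_iff minus_le_iff)
      have "x \<tau> \<in> K"
        using \<tau> dist[of \<tau>] ms by (auto simp: K_def dist_norm norm_minus_commute)
      then have "dist (p + s *\<^sub>R v) (\<gamma> s) \<le> dist (p + s *\<^sub>R v) (x \<tau>)"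
        using closest_point_le[OF \<open>closed K\<close>] by (simp add: \<gamma>_def)
      also have "\<dots> = \<bar>\<tau>\<bar> * norm g" by (simp add: x_def dist_norm)
      also have "\<dots> \<le> h * norm g" using \<tau> by (intro mult_right_mono) auto
      also have "\<dots> = e * \<bar>s\<bar>" using pos by (simp add: h_def \<eta>_def)
      finally show ?thesis by (simp add: dist_norm norm_minus_commute)
    qed
    ultimately show ?thesis by blast
  qed
  have "(\<gamma> has_vector_derivative v) (at 0)"
    unfolding has_vector_derivative_def has_derivative_at_alt
    using near by (auto simp: \<gamma>0 bounded_linear_scaleR_left algebra_simps)
  then show "v \<in> tangent_space S p"
    unfolding tangent_space_def using \<gamma>0 \<gamma>S by (auto intro!: exI[of _ \<gamma>] exI[of _ 1])
qed

section \<open>Traces in orthonormal bases\<close>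

lemma euclidean_inner_orthonormal_basis:
  fixes B :: "'a::euclidean_space set"
  assumes "orthonormal_basis_of UNIV B" "finite B"
  shows "x \<bullet> y = (\<Sum>e\<in>B. (x \<bullet> e) * (y \<bullet> e))"
proof -
  have "x = (\<Sum>e\<in>B. (x \<bullet> e) *\<^sub>R e)"
    using assms by (subst orthonormal_basis_expand) (auto simp: orthonormal_basis_of_def)
  then have "x \<bullet> y = (\<Sum>e\<in>B. (x \<bullet> e) *\<^sub>R e) \<bullet> y" by (rule arg_cong)
  also have "\<dots> = (\<Sum>e\<in>B. (x \<bullet> e) * (y \<bullet> e))"
    unfolding inner_sum_left by (intro sum.cong) (simp_all add: inner_commute)
  finally show ?thesis .
qed

lemma orthonormal_basis_of_finite:
  fixes B :: "'a::euclidean_space set"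
  assumes "orthonormal_basis_of V B"
  shows "finite B"
proof -
  have "0 \<notin> B" using assms by (force simp: orthonormal_basis_of_def)
  then show ?thesis
    using assms independent_bound[OF pairwise_orthogonal_independent, of B]
    by (simp add: orthonormal_basis_of_def)
qed

text \<open>Expand in \<open>Basis\<close>, swap the two sums, carry \<open>A\<close> over by its
  adjoint, and contract in \<open>B\<close>.\<close>

lemma trace_orthonormal_basis:
  fixes A :: "'a::euclidean_space \<Rightarrow> 'a"
  assumes A: "linear A" and B: "orthonormal_basis_of UNIV B"
  shows "(\<Sum>e\<in>B. A e \<bullet> e) = (\<Sum>b\<in>Basis. A b \<bullet> b)"
proof -
  note fin = orthonormal_basis_of_finite[OF B]
  have "(\<Sum>e\<in>B. A e \<bullet> e) = (\<Sum>e\<in>B. \<Sum>b\<in>Basis. (A e \<bullet> b) * (e \<bullet> b))"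
    by (simp flip: euclidean_inner)
  also have "\<dots> = (\<Sum>b\<in>Basis. \<Sum>e\<in>B. (adjoint A b \<bullet> e) * (b \<bullet> e))"
    by (subst sum.swap) (simp add: adjoint_works[OF A] inner_commute)
  also have "\<dots> = (\<Sum>b\<in>Basis. adjoint A b \<bullet> b)"
    by (simp flip: euclidean_inner_orthonormal_basis[OF B fin])
  also have "\<dots> = (\<Sum>b\<in>Basis. A b \<bullet> b)"
    by (simp add: adjoint_works[OF A] inner_commute)
  finally show ?thesis .
qed

text \<open>Adding the unit normal \<open>n\<close> to \<open>B\<close> gives an orthonormal basis
  of the whole space, so the full trace exceeds the sum over \<open>B\<close> by the normal entry
  \<open>A n \<bullet> n\<close>.\<close>

lemma trace_orthogonal_complement:
  fixes A :: "'a::euclidean_space \<Rightarrow> 'a"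
  assumes A: "linear A" and "g \<noteq> 0" and B: "orthonormal_basis_of {v. g \<bullet> v = 0} B"
  shows "(\<Sum>e\<in>B. A e \<bullet> e) = (\<Sum>b\<in>Basis. A b \<bullet> b) - (A g \<bullet> g) / (g \<bullet> g)"
proof -
  define n where "n = g /\<^sub>R norm g"
  have sp: "span B = {v. g \<bullet> v = 0}" using B by (simp add: orthonormal_basis_of_def)
  have perp: "g \<bullet> e = 0" if "e \<in> B" for e using span_base[OF that] by (simp add: sp)
  have "n \<notin> B" using perp[of n] \<open>g \<noteq> 0\<close> by (auto simp: n_def)
  have "x \<in> span (insert n B)" for x
  proof -
    have "x - (g \<bullet> x / norm g) *\<^sub>R n \<in> span B"
      using \<open>g \<noteq> 0\<close> by (simp add: sp n_def inner_diff_right dot_square_norm power2_eq_square)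
    then show ?thesis by (auto simp: span_insert)
  qed
  then have "orthonormal_basis_of UNIV (insert n B)"
    using B perp \<open>g \<noteq> 0\<close>
    by (auto simp: orthonormal_basis_of_def pairwise_insert orthogonal_def n_def inner_commute)
  from trace_orthonormal_basis[OF A this]
  have "(\<Sum>b\<in>Basis. A b \<bullet> b) = A n \<bullet> n + (\<Sum>e\<in>B. A e \<bullet> e)"
    using \<open>n \<notin> B\<close> orthonormal_basis_of_finite[OF B] by simp
  moreover have "A n \<bullet> n = (A g \<bullet> g) / (g \<bullet> g)"
    using \<open>g \<noteq> 0\<close> by (simp add: n_def linear_cmul[OF A] dot_square_norm power2_eq_square field_simps)
  ultimately show ?thesis by simp
qed

section \<open>Curvature of a level set\<close>

text \<open>\<open>G' x\<close> is the Hessian of \<open>f\<close> at \<open>x\<close>, as an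
  operator. \<open>S\<close> and the zero set are compared only inside \<open>U\<close>, which
  suffices because curvature is local.\<close>

locale level_set =
  fixes S U :: "'a::euclidean_space set" and f :: "'a \<Rightarrow> real" and G :: "'a \<Rightarrow> 'a"
    and G' :: "'a \<Rightarrow> 'a \<Rightarrow> 'a"
  assumes open_domain: "open U"
    and level: "S \<inter> U = {x \<in> U. f x = 0}"
    and gradient: "x \<in> U \<Longrightarrow> GDERIV f x :> G x"
    and gradient_nonzero: "x \<in> U \<Longrightarrow> G x \<noteq> 0"
    and hessian: "x \<in> U \<Longrightarrow> (G has_derivative G' x) (at x)"
begin

lemma continuous_on_defining: "continuous_on U f"
  using gradient open_domain
  by (auto simp: continuous_on_eq_continuous_at gderiv_def dest: has_derivative_continuous)

text \<open>A local unit normal field is tested against the tangent spaces of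
  \<open>S \<inter> V\<close>; this identifies them with those of \<open>S\<close>, the case
  \<open>V = UNIV\<close>.\<close>

lemma tangent_space_Int:
  assumes "open V" "p \<in> S \<inter> U \<inter> V"
  shows "tangent_space (S \<inter> V) p = {v. G p \<bullet> v = 0}"
proof (rule tangent_space_level_set)
  show "open (U \<inter> V)" using open_domain assms by blast
  show "(S \<inter> V) \<inter> (U \<inter> V) = {x \<in> U \<inter> V. f x = 0}" using level by blast
  show "continuous_on (U \<inter> V) f" using continuous_on_defining continuous_on_subset by blast
qed (use assms gradient gradient_nonzero in auto)

lemma tangent_space_eq: "p \<in> S \<inter> U \<Longrightarrow> tangent_space S p = {v. G p \<bullet> v = 0}"
  using tangent_space_Int[of UNIV p] by simp

text \<open>On \<open>S\<close> near \<open>p\<close> one has \<open>G = a N\<close> with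
  \<open>a = G \<bullet> N\<close>. Differentiating along a curve with velocity \<open>u\<close> and
  pairing with the tangent vector \<open>v\<close> removes the term in \<open>N\<close>, leaving
  \<open>G' p u \<bullet> v = a (N' u \<bullet> v)\<close>, and \<open>a\<close> squared is
  \<open>G p \<bullet> G p\<close>. Since \<open>N\<close> is arbitrary, the right-hand side is the
  same for all choices.\<close>

lemma unit_normal_derivative:
  assumes p: "p \<in> S \<inter> U" and V: "open V" "p \<in> V" and N: "unit_normal_field (S \<inter> V) N"
    and N': "(N has_derivative N') (at p within S)" and u: "u \<in> tangent_space S p"
    and v: "v \<in> tangent_space S p"
  shows "(N' u \<bullet> v) *\<^sub>R N p = ((G' p u \<bullet> v) / (G p \<bullet> G p)) *\<^sub>R G p"
proof -
  have normal: "G q = (G q \<bullet> N q) *\<^sub>R N q" if q: "q \<in> S \<inter> U \<inter> V" for q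
  proof -
    have N1: "norm (N q) = 1" and Nt: "\<And>w. G q \<bullet> w = 0 \<Longrightarrow> N q \<bullet> w = 0"
      using N q tangent_space_Int[OF V(1) q] by (auto simp: unit_normal_field_def)
    \<comment> \<open>Up to the factor \<open>G q \<bullet> G q\<close>, this is the part of
      \<open>N q\<close> orthogonal to \<open>G q\<close>. It is tangent, hence orthogonal to
      \<open>N q\<close> as well, and so vanishes.\<close>
    define w where "w = (G q \<bullet> G q) *\<^sub>R N q - (G q \<bullet> N q) *\<^sub>R G q"
    have "G q \<bullet> w = 0" by (simp add: w_def inner_diff_right)
    then have "N q \<bullet> w = 0" by (rule Nt)
    then have "w \<bullet> w = 0"
      using \<open>G q \<bullet> w = 0\<close> by (simp add: w_def inner_diff_left)
    then have eq: "(G q \<bullet> G q) *\<^sub>R N q = (G q \<bullet> N q) *\<^sub>R G q" by (simp add: w_def)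
    have "(G q \<bullet> G q) *\<^sub>R ((G q \<bullet> N q) *\<^sub>R N q) = (G q \<bullet> N q) *\<^sub>R ((G q \<bullet> G q) *\<^sub>R N q)"
      by (simp add: mult.commute)
    also have "\<dots> = (G q \<bullet> N q)\<^sup>2 *\<^sub>R G q" by (simp add: eq power2_eq_square)
    also have "(G q \<bullet> N q)\<^sup>2 = G q \<bullet> G q"
      using arg_cong[OF eq, of "\<lambda>w. w \<bullet> N q"] N1 by (simp add: dot_square_norm power2_eq_square)
    finally have "(G q \<bullet> G q) *\<^sub>R ((G q \<bullet> N q) *\<^sub>R N q) = (G q \<bullet> G q) *\<^sub>R G q" .
    moreover have "G q \<bullet> G q \<noteq> 0" using gradient_nonzero q by simp
    ultimately show ?thesis by (metis scaleR_cancel_left)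
  qed
  obtain \<gamma> \<epsilon> where e: "\<epsilon> > 0" and S: "\<And>s. s \<in> {-\<epsilon><..<\<epsilon>} \<Longrightarrow> \<gamma> s \<in> S" and \<gamma>0: "\<gamma> 0 = p"
    and der: "(\<gamma> has_derivative (\<lambda>s. s *\<^sub>R u)) (at (0::real))"
    using u unfolding tangent_space_def has_vector_derivative_def by blast
  have "isCont \<gamma> 0" using der by (rule has_derivative_continuous)
  then have "\<forall>\<^sub>F s in at 0. \<gamma> s \<in> U \<inter> V"
    unfolding isCont_def using p V \<gamma>0 open_domain
    by (intro topological_tendstoD[where f = \<gamma>]) auto
  moreover have ev: "\<forall>\<^sub>F s in at 0. s \<in> {-\<epsilon><..<\<epsilon>}"
    using e by (intro eventually_at_in_open') auto
  ultimately have near: "\<forall>\<^sub>F s in at 0. \<gamma> s \<in> S \<inter> U \<inter> V"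
    by eventually_elim (use S in blast)
  have dG: "((\<lambda>s. G (\<gamma> s)) has_derivative (\<lambda>s. G' p (s *\<^sub>R u))) (at 0)"
    using hessian[of p] p \<gamma>0 by (intro has_derivative_compose[OF der]) auto
  \<comment> \<open>\<open>N\<close> is differentiable only within \<open>S\<close>, so the
    composition is taken within the interval that \<open>\<gamma>\<close> maps into
    \<open>S\<close>; that interval is open, which gives the full derivative at
    \<open>0\<close>.\<close>
  have dN: "((\<lambda>s. N (\<gamma> s)) has_derivative (\<lambda>s. N' (s *\<^sub>R u))) (at 0)"
  proof -
    have "(\<gamma> has_derivative (\<lambda>s. s *\<^sub>R u)) (at 0 within {-\<epsilon><..<\<epsilon>})"
      using der by (rule has_derivative_at_withinI)
    moreover have "(N has_derivative N') (at (\<gamma> 0) within \<gamma> ` {-\<epsilon><..<\<epsilon>})"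
      using N' S \<gamma>0 by (auto intro: has_derivative_subset)
    ultimately have "((\<lambda>s. N (\<gamma> s)) has_derivative (\<lambda>s. N' (s *\<^sub>R u))) (at 0 within {-\<epsilon><..<\<epsilon>})"
      by (rule has_derivative_in_compose)
    then show ?thesis using e by (simp add: at_within_open[of 0 "{-\<epsilon><..<\<epsilon>}"])
  qed
  \<comment> \<open>The scalar is plus or minus the norm of \<open>G\<close>; written as an inner
    product it is visibly differentiable along \<open>\<gamma>\<close>.\<close>
  define a where "a s = G (\<gamma> s) \<bullet> N (\<gamma> s)" for s
  define a' where "a' s = G (\<gamma> 0) \<bullet> N' (s *\<^sub>R u) + G' p (s *\<^sub>R u) \<bullet> N (\<gamma> 0)" for s
  have da: "(a has_derivative a') (at 0)"
    unfolding a_def[abs_def] a'_def[abs_def] by (rule has_derivative_inner[OF dG dN])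
  have Gp: "G p = a 0 *\<^sub>R N p" unfolding a_def \<gamma>0 using p V by (intro normal) auto
  have "((\<lambda>s. a s *\<^sub>R N (\<gamma> s)) has_derivative (\<lambda>s. a 0 *\<^sub>R N' (s *\<^sub>R u) + a' s *\<^sub>R N (\<gamma> 0))) (at 0)"
    by (rule has_derivative_scaleR[OF da dN])
  moreover have "\<forall>\<^sub>F s in at 0. a s *\<^sub>R N (\<gamma> s) = G (\<gamma> s)"
    using near by eventually_elim (simp add: a_def flip: normal)
  ultimately have "((\<lambda>s. G (\<gamma> s)) has_derivative (\<lambda>s. a 0 *\<^sub>R N' (s *\<^sub>R u) + a' s *\<^sub>R N (\<gamma> 0))) (at 0)"
    by (rule has_derivative_transform_eventually) (use Gp \<gamma>0 in auto)
  from has_derivative_unique[OF dG this]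
  have "G' p (1 *\<^sub>R u) = a 0 *\<^sub>R N' (1 *\<^sub>R u) + a' 1 *\<^sub>R N (\<gamma> 0)" by (rule fun_cong)
  moreover have "N p \<bullet> v = 0"
    using N p V v tangent_space_Int[OF V(1), of p] tangent_space_eq[OF p]
    by (auto simp: unit_normal_field_def)
  ultimately have G'v: "G' p u \<bullet> v = a 0 * (N' u \<bullet> v)" by (simp add: inner_add_left \<gamma>0)
  have "norm (N p) = 1" using N p V by (auto simp: unit_normal_field_def)
  then have "G p \<bullet> G p = a 0 * a 0" by (simp add: Gp dot_square_norm power2_eq_square)
  moreover have "a 0 \<noteq> 0" using gradient_nonzero[of p] p Gp by auto
  ultimately show ?thesis by (simp add: G'v) (simp add: Gp)
qed

text \<open>The normalised gradient witnesses existence for the definite description;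
  \<open>unit_normal_derivative\<close>, applied to any admissible field, gives uniqueness.\<close>

lemma second_fundamental_form_eq:
  assumes p: "p \<in> S \<inter> U" and u: "u \<in> tangent_space S p" and v: "v \<in> tangent_space S p"
  shows "second_fundamental_form S p u v = - ((G' p u \<bullet> v) / (G p \<bullet> G p)) *\<^sub>R G p"
    (is "_ = ?w")
proof -
  define N where "N x = inverse (norm (G x)) *\<^sub>R G x" for x
  have N_at: "N differentiable (at x)" if "x \<in> U" for x
  proof -
    have G: "G differentiable (at x)" using hessian[OF that] by (rule differentiableI)
    then have "(\<lambda>x. norm (G x)) differentiable (at x)"
      using differentiable_chain_at[OF G differentiable_norm_at] gradient_nonzero[OF that]
      by (simp add: o_def)
    then show ?thesis
      unfolding N_def[abs_def] using G gradient_nonzero[OF that]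
      by (intro differentiable_scaleR differentiable_inverse) auto
  qed
  have unit: "unit_normal_field (S \<inter> U) N"
    unfolding unit_normal_field_def
  proof (intro conjI ballI)
    show "N differentiable_on S \<inter> U"
      using N_at by (auto intro!: differentiable_at_imp_differentiable_on)
  next
    fix q assume "q \<in> S \<inter> U"
    then show "norm (N q) = 1" using gradient_nonzero[of q] by (simp add: N_def)
  next
    fix q v assume "q \<in> S \<inter> U" "v \<in> tangent_space (S \<inter> U) q"
    then show "N q \<bullet> v = 0" using tangent_space_Int[OF open_domain, of q] by (simp add: N_def)
  qed
  obtain N' where N': "(N has_derivative N') (at p within S)"
    using N_at p by (auto simp: differentiable_def intro: has_derivative_at_withinI)
  show ?thesis
    unfolding second_fundamental_form_def
  proof (rule the_equality)
    have "?w = - (N' u \<bullet> v) *\<^sub>R N p"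
      using unit_normal_derivative[OF p open_domain _ unit N' u v] p by simp
    then show "\<exists>V N N'. open V \<and> p \<in> V \<and> unit_normal_field (S \<inter> V) N \<and>
        (N has_derivative N') (at p within S) \<and> ?w = - (N' u \<bullet> v) *\<^sub>R N p"
      using open_domain p unit N' by blast
  next
    fix w assume "\<exists>V N N'. open V \<and> p \<in> V \<and> unit_normal_field (S \<inter> V) N \<and>
        (N has_derivative N') (at p within S) \<and> w = - (N' u \<bullet> v) *\<^sub>R N p"
    then obtain V N N' where "open V" "p \<in> V" "unit_normal_field (S \<inter> V) N"
      "(N has_derivative N') (at p within S)" and w: "w = - (N' u \<bullet> v) *\<^sub>R N p"
      by blast
    from unit_normal_derivative[OF p this(1-4) u v] show "w = ?w" by (simp add: w)
  qed
qed

lemma mean_curvature_vector_eq: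
  assumes p: "p \<in> S \<inter> U"
  shows "mean_curvature_vector S p =
    - (((\<Sum>b\<in>Basis. G' p b \<bullet> b) - (G' p (G p) \<bullet> G p) / (G p \<bullet> G p)) / (G p \<bullet> G p)) *\<^sub>R G p"
proof -
  \<comment> \<open>The basis picked by \<open>SOME\<close> is known to be orthonormal only once one
    is shown to exist.\<close>
  define B where "B = (SOME B. orthonormal_basis_of (tangent_space S p) B)"
  have "subspace {v. G p \<bullet> v = 0}" by (rule subspace_hyperplane)
  then have "\<exists>B. orthonormal_basis_of (tangent_space S p) B"
    unfolding tangent_space_eq[OF p] orthonormal_basis_of_def
    by (metis orthonormal_basis_subspace)
  then have B: "orthonormal_basis_of (tangent_space S p) B"
    unfolding B_def by (rule someI_ex)
  then have "B \<subseteq> tangent_space S p" by (auto simp: orthonormal_basis_of_def intro: span_base)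
  then have "mean_curvature_vector S p = (\<Sum>e\<in>B. - ((G' p e \<bullet> e) / (G p \<bullet> G p)) *\<^sub>R G p)"
    unfolding mean_curvature_vector_def B_def[symmetric]
    by (intro sum.cong refl second_fundamental_form_eq[OF p]) auto
  also have "\<dots> = - ((\<Sum>e\<in>B. G' p e \<bullet> e) / (G p \<bullet> G p)) *\<^sub>R G p"
    by (simp add: sum_divide_distrib scaleR_sum_left sum_negf)
  also have "(\<Sum>e\<in>B. G' p e \<bullet> e) = (\<Sum>b\<in>Basis. G' p b \<bullet> b) - (G' p (G p) \<bullet> G p) / (G p \<bullet> G p)"
    using B p hessian[of p] gradient_nonzero[of p]
    by (intro trace_orthogonal_complement) (auto simp: tangent_space_eq has_derivative_linear)
  finally show ?thesis .
qed

lemma C2_hypersurface_level_set: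
  assumes "S \<subseteq> U" and "\<And>b. b \<in> Basis \<Longrightarrow> continuous_on U (\<lambda>x. G' x b)"
  shows "C2_hypersurface S"
proof -
  have "C1_on U G"
    unfolding C1_on_def
  proof (intro exI conjI ballI)
    have blin: "blinfun_apply (Blinfun (G' x)) = G' x" if "x \<in> U" for x
      using hessian[OF that] by (simp add: bounded_linear_Blinfun_apply has_derivative_bounded_linear)
    show "(G has_derivative blinfun_apply (Blinfun (G' x))) (at x)" if "x \<in> U" for x
      using hessian[OF that] blin[OF that] by simp
    \<comment> \<open>In finite dimension, continuity in the operator norm can be checked on basis
      vectors. \<open>Blinfun\<close> is evaluated only on \<open>U\<close>, where
      \<open>G' x\<close> is bounded linear.\<close>
    show "continuous_on U (\<lambda>x. Blinfun (G' x))"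
    proof (rule continuous_on_blinfun_componentwise)
      fix b :: 'a assume "b \<in> Basis"
      then show "continuous_on U (\<lambda>x. blinfun_apply (Blinfun (G' x)) b)"
        using assms(2) blin by (simp cong: continuous_on_cong)
    qed
  qed
  then show ?thesis
    unfolding C2_hypersurface_def
    using assms(1) open_domain level gradient gradient_nonzero
    by (intro ballI exI[of _ U] exI[of _ f] exI[of _ G]) auto
qed

end

section \<open>Coordinates and dilations\<close>

lemma sum_Basis_vec:
  fixes h :: "real^'n \<Rightarrow> 'b::comm_monoid_add"
  shows "(\<Sum>b\<in>Basis. h b) = (\<Sum>i\<in>UNIV. h (axis i 1))"
proof -
  have inj: "inj (\<lambda>i::'n. axis i (1::real))" by (simp add: inj_on_def axis_eq_axis)
  have Basis: "(Basis :: (real^'n) set) = range (\<lambda>i. axis i 1)"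
    by (auto simp: Basis_vec_def)
  show ?thesis by (simp only: Basis sum.reindex[OF inj] o_def)
qed

lemma vector_4 [simp]:
  "(vector [x, y, z, w] :: 'a::zero^4) $ 1 = x"
  "(vector [x, y, z, w] :: 'a::zero^4) $ 2 = y"
  "(vector [x, y, z, w] :: 'a::zero^4) $ 3 = z"
  "(vector [x, y, z, w] :: 'a::zero^4) $ 4 = w"
  unfolding vector_def by simp_all

lemma has_derivative_vec_componentwise:
  fixes f :: "'a::real_normed_vector \<Rightarrow> real^'n"
  assumes "\<And>i. ((\<lambda>x. f x $ i) has_derivative (\<lambda>h. f' h $ i)) (at x within S)"
  shows "(f has_derivative f') (at x within S)"
  using assms
  by (subst has_derivative_componentwise_within)
     (auto simp: Basis_vec_def simp flip: cart_eq_inner_axis)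

lemma continuous_on_vec_componentwise:
  fixes f :: "'a::topological_space \<Rightarrow> real^'n"
  assumes "\<And>i. continuous_on S (\<lambda>x. f x $ i)"
  shows "continuous_on S f"
  using continuous_on_vec_lambda[of S "\<lambda>i x. f x $ i"] assms by simp

lemma has_derivative_vec_nth' [derivative_intros]:
  "(f has_derivative f') F \<Longrightarrow> ((\<lambda>x. f x $ i) has_derivative (\<lambda>h. f' h $ i)) F"
  by (rule bounded_linear.has_derivative[OF bounded_linear_vec_nth])

lemma inner_3: "x \<bullet> y = x $ 1 * y $ 1 + x $ 2 * y $ 2 + x $ 3 * y $ 3" for x y :: "real^3"
  by (simp add: inner_vec_def sum_3)

lemma inner_4:
  "x \<bullet> y = x $ 1 * y $ 1 + x $ 2 * y $ 2 + x $ 3 * y $ 3 + x $ 4 * y $ 4" for x y :: "real^4"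
  by (simp add: inner_vec_def sum_4)

lemma pair_sum_resonantI:
  assumes "card P = 2" "card Q = 2" "P \<noteq> Q" "(\<Sum>i\<in>P. g $ i) = (\<Sum>i\<in>Q. g $ i)"
  shows "pair_sum_resonant g"
  using assms by (auto simp: pair_sum_nonresonant_def inj_on_def)

text \<open>Dilations by \<open>t\<close> and \<open>inverse t\<close> are mutually inverse, so the
  image of a set given by equations is found by substitution.\<close>

lemma mem_dilation_image_iff:
  assumes "t > 0"
  shows "x \<in> dilation g t ` A \<longleftrightarrow> dilation g (inverse t) x \<in> A"
proof
  have inv: "dilation g t (dilation g (inverse t) x) = x" "dilation g (inverse t) (dilation g t x) = x" for x
    using assms by (simp_all add: dilation_def vec_eq_iff powr_mult[symmetric] flip: mult.assoc)
  show "dilation g (inverse t) x \<in> A" if "x \<in> dilation g t ` A" using that inv by auto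
  show "x \<in> dilation g t ` A" if "dilation g (inverse t) x \<in> A" using that inv by (metis imageI)
qed

section \<open>The helicoid\<close>

definition quadrant :: "(real^3) set" where
  "quadrant = {x. x $ 1 > 0 \<and> x $ 2 > 0}"

definition arctan_grad :: "real \<Rightarrow> real^3 \<Rightarrow> real^3" where
  "arctan_grad c x = vector
     [c * x $ 2 / ((x $ 1)\<^sup>2 + (x $ 2)\<^sup>2), - c * x $ 1 / ((x $ 1)\<^sup>2 + (x $ 2)\<^sup>2), 1]"

text \<open>The Hessian of \<open>x $ 3 - c * arctan (x $ 2 / x $ 1)\<close>, that is
  \<open>- c\<close> times the Hessian of the polar angle, a harmonic function; hence the zero
  trace.\<close>

definition arctan_hess :: "real \<Rightarrow> real^3 \<Rightarrow> real^3 \<Rightarrow> real^3" where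
  "arctan_hess c x h = (c / ((x $ 1)\<^sup>2 + (x $ 2)\<^sup>2)\<^sup>2) *\<^sub>R vector
     [- 2 * x $ 1 * x $ 2 * h $ 1 + ((x $ 1)\<^sup>2 - (x $ 2)\<^sup>2) * h $ 2,
      ((x $ 1)\<^sup>2 - (x $ 2)\<^sup>2) * h $ 1 + 2 * x $ 1 * x $ 2 * h $ 2, 0]"

lemma open_quadrant: "open quadrant"
  unfolding quadrant_def
  by (intro open_Collect_conj open_Collect_less continuous_intros)

lemma arctan_level_set:
  "level_set (arctan_graph c) quadrant (\<lambda>x. x $ 3 - c * arctan (x $ 2 / x $ 1))
     (arctan_grad c) (arctan_hess c)"
proof
  fix x :: "real^3" assume "x \<in> quadrant"
  then have x: "x $ 1 > 0" "x $ 2 > 0" by (auto simp: quadrant_def)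
  then have r: "(x $ 1)\<^sup>2 + (x $ 2)\<^sup>2 > 0" by (simp add: sum_power2_gt_zero_iff)
  let ?r = "\<lambda>x. (x $ 1)\<^sup>2 + (x $ 2)\<^sup>2"
  have "((\<lambda>x. x $ 3 - c * arctan (x $ 2 / x $ 1)) has_derivative
      (\<lambda>h. h $ 3 - c * (inverse (1 + (x $ 2 / x $ 1)\<^sup>2) * ((h $ 2 * x $ 1 - x $ 2 * h $ 1) / (x $ 1 * x $ 1))))) (at x)"
    using x by (auto intro!: derivative_eq_intros simp: fun_eq_iff)
  moreover have "inverse (1 + (x $ 2 / x $ 1)\<^sup>2) = (x $ 1 * x $ 1) / ?r x"
    using x r by (simp add: power2_eq_square field_simps)
  ultimately show "GDERIV (\<lambda>x. x $ 3 - c * arctan (x $ 2 / x $ 1)) x :> arctan_grad c x"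
    unfolding gderiv_def using x
    by (elim has_derivative_eq_rhs)
       (simp add: fun_eq_iff inner_3 arctan_grad_def right_diff_distrib diff_divide_distrib mult_ac)
  have "arctan_grad c x $ 3 = 1" by (simp add: arctan_grad_def)
  then show "arctan_grad c x \<noteq> 0" by auto
  show "(arctan_grad c has_derivative arctan_hess c x) (at x)"
  proof (rule has_derivative_vec_componentwise)
    fix i :: 3
    \<comment> \<open>One quotient rule covers both nonconstant gradient entries, with
      \<open>k = c\<close>, \<open>j = 2\<close> and \<open>k = - c\<close>,
      \<open>j = 1\<close>.\<close>
    have quot: "((\<lambda>x. k * (x $ j / ?r x)) has_derivative
        (\<lambda>h. k * ((h $ j * ?r x - x $ j * (2 * x $ 1 * h $ 1 + 2 * x $ 2 * h $ 2)) / (?r x * ?r x)))) (at x)" for j k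
      using r by (auto intro!: derivative_eq_intros simp: fun_eq_iff algebra_simps)
    show "((\<lambda>x. arctan_grad c x $ i) has_derivative (\<lambda>h. arctan_hess c x h $ i)) (at x)"
      using exhaust_3[of i]
    proof (elim disjE)
      assume "i = 1"
      then show ?thesis
        using quot[of c 2]
        by (simp add: arctan_grad_def arctan_hess_def power2_eq_square algebra_simps)
    next
      assume "i = 2"
      then show ?thesis
        using quot[of "- c" 1]
        by (simp add: arctan_grad_def arctan_hess_def power2_eq_square algebra_simps)
    next
      assume "i = 3"
      then show ?thesis by (simp add: arctan_grad_def arctan_hess_def)
    qed
  qed
qed (use open_quadrant in \<open>auto simp: arctan_graph_def quadrant_def\<close>)

lemma C2_hypersurface_arctan_graph: "C2_hypersurface (arctan_graph c)"
proof -
  interpret level_set "arctan_graph c" quadrant "\<lambda>x. x $ 3 - c * arctan (x $ 2 / x $ 1)"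
    "arctan_grad c" "arctan_hess c"
    by (rule arctan_level_set)
  have "continuous_on quadrant (\<lambda>x. arctan_hess c x h)" for h
  proof (rule continuous_on_vec_componentwise)
    fix i :: 3
    have r: "(x $ 1)\<^sup>2 + (x $ 2)\<^sup>2 \<noteq> 0" if "x \<in> quadrant" for x :: "real^3"
      using that by (auto simp: quadrant_def sum_power2_eq_zero_iff)
    show "continuous_on quadrant (\<lambda>x. arctan_hess c x h $ i)"
      unfolding arctan_hess_def
      using exhaust_3[of i] r by (elim disjE) (auto intro!: continuous_intros)
  qed
  then show ?thesis
    by (intro C2_hypersurface_level_set) (auto simp: arctan_graph_def quadrant_def)
qed

lemma minimal_arctan_graph: "minimal_hypersurface (arctan_graph c)"
proof -
  interpret level_set "arctan_graph c" quadrant "\<lambda>x. x $ 3 - c * arctan (x $ 2 / x $ 1)"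
    "arctan_grad c" "arctan_hess c"
    by (rule arctan_level_set)
  have "mean_curvature_vector (arctan_graph c) p = 0" if "p \<in> arctan_graph c" for p
  proof -
    have p: "p \<in> arctan_graph c \<inter> quadrant" using that by (auto simp: arctan_graph_def quadrant_def)
    have "(\<Sum>b\<in>Basis. arctan_hess c p b \<bullet> b) = 0"
      by (simp add: sum_Basis_vec sum_3 inner_3 arctan_hess_def axis_def)
    moreover have "arctan_hess c p (arctan_grad c p) \<bullet> arctan_grad c p = 0"
    proof -
      \<comment> \<open>The numerators cancel for any value of \<open>r\<close>, so it can stay
        opaque.\<close>
      define r where "r = (p $ 1)\<^sup>2 + (p $ 2)\<^sup>2"
      show ?thesis
        by (simp add: inner_3 arctan_hess_def arctan_grad_def flip: r_def)
           (simp add: divide_simps, simp add: algebra_simps power2_eq_square)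
    qed
    ultimately show ?thesis using mean_curvature_vector_eq[OF p] by simp
  qed
  then show ?thesis by (simp add: minimal_hypersurface_def C2_hypersurface_arctan_graph)
qed

lemma nonflat_arctan_graph:
  assumes "c \<noteq> 0"
  shows "nonflat_hypersurface (arctan_graph c)"
proof -
  interpret level_set "arctan_graph c" quadrant "\<lambda>x. x $ 3 - c * arctan (x $ 2 / x $ 1)"
    "arctan_grad c" "arctan_hess c"
    by (rule arctan_level_set)
  \<comment> \<open>At \<open>p\<close> the gradient is \<open>(c/2, - c/2, 1)\<close>, orthogonal
    to \<open>u\<close>, and the Hessian form takes the value \<open>- 2 c\<close> on
    \<open>u\<close>.\<close>
  define p u :: "real^3" where "p = vector [1, 1, c * (pi / 4)]" and "u = vector [2, 0, - c]"
  have p: "p \<in> arctan_graph c" "p \<in> quadrant"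
    by (simp_all add: p_def arctan_graph_def quadrant_def arctan_one)
  have u: "u \<in> tangent_space (arctan_graph c) p"
    using p by (simp add: tangent_space_eq inner_3 arctan_grad_def p_def u_def)
  have "arctan_hess c p u \<bullet> u \<noteq> 0"
    using assms by (simp add: inner_3 arctan_hess_def p_def u_def)
  then have "second_fundamental_form (arctan_graph c) p u u \<noteq> 0"
    using p u gradient_nonzero by (simp add: second_fundamental_form_eq)
  then show ?thesis
    using p u by (auto simp: nonflat_hypersurface_def C2_hypersurface_arctan_graph)
qed

text \<open>The graph equation says that \<open>x $ 3 / c\<close> is the polar angle, which is the
  helicoid parameter \<open>v\<close> restricted to values between \<open>0\<close> and
  \<open>pi / 2\<close>.\<close>

lemma helicoid_patch_arctan_graph:
  assumes "c \<noteq> 0"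
  shows "helicoid_patch (arctan_graph c)"
proof -
  \<comment> \<open>The bounds on \<open>x $ 3 / c\<close> select one of the sheets of the helicoid over the quadrant.\<close>
  define W :: "(real^3) set" where "W = {x. x $ 1 > 0 \<and> x $ 2 > 0 \<and> 0 < x $ 3 / c \<and> x $ 3 / c < pi / 2}"
  have "open W"
    unfolding W_def using assms
    by (intro open_Collect_conj open_Collect_less continuous_intros) auto
  have "arctan_graph c = helicoid c \<inter> W"
  proof (intro set_eqI iffI)
    fix x assume "x \<in> arctan_graph c"
    then have x: "x $ 1 > 0" "x $ 2 > 0" "x $ 3 = c * arctan (x $ 2 / x $ 1)"
      by (auto simp: arctan_graph_def)
    have "x \<in> W"
      using x assms arctan_ubound by (simp add: W_def)
    moreover have "x \<in> helicoid c"
    proof -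
      \<comment> \<open>The helicoid parameters are the polar angle \<open>v\<close> and the radius
        \<open>x $ 1 / cos v\<close>.\<close>
      define v where "v = arctan (x $ 2 / x $ 1)"
      have "cos v > 0" using arctan[of "x $ 2 / x $ 1"] by (auto simp: v_def intro!: cos_gt_zero_pi)
      moreover have "tan v = x $ 2 / x $ 1" by (simp add: v_def arctan)
      ultimately have "sin v = x $ 2 / x $ 1 * cos v" by (simp add: tan_def field_simps)
      then have "x = vector [x $ 1 / cos v * cos v, x $ 1 / cos v * sin v, c * v]"
        using \<open>cos v > 0\<close> x by (simp add: vec_eq_iff forall_3 v_def)
      then show ?thesis unfolding helicoid_def by blast
    qed
    ultimately show "x \<in> helicoid c \<inter> W" by blast
  next
    fix x assume "x \<in> helicoid c \<inter> W"
    then obtain u v where x: "x = vector [u * cos v, u * sin v, c * v]" and "x \<in> W"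
      by (auto simp: helicoid_def)
    then have W: "u * cos v > 0" "u * sin v > 0" "0 < v" "v < pi / 2"
      using assms by (auto simp: W_def)
    then have "u * sin v / (u * cos v) = tan v" by (auto simp: tan_def)
    then have "arctan (u * sin v / (u * cos v)) = v" using W by (simp add: arctan_tan)
    then show "x \<in> arctan_graph c" using W by (simp add: x arctan_graph_def)
  qed
  \<comment> \<open>The identity is written in the form \<open>a + T x\<close> of a rigid
    motion.\<close>
  then have "openin (top_of_set ((\<lambda>x. 0 + id x) ` helicoid c)) (arctan_graph c)"
    using \<open>open W\<close> by (simp add: openin_open_Int)
  moreover have "rigid_motion (\<lambda>x. 0 + id x)"
    unfolding rigid_motion_def using orthogonal_transformation_id by (metis id_def)
  moreover have "vector [1, 1, c * arctan 1] \<in> arctan_graph c" by (simp add: arctan_graph_def)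
  ultimately show ?thesis
    unfolding helicoid_patch_def using assms by blast
qed

text \<open>Equal weights preserve the ratio \<open>x $ 2 / x $ 1\<close>, so only the factor on the
  third coordinate remains, and \<open>c\<close> absorbs it.\<close>

lemma dilation_arctan_graph:
  fixes \<gamma> :: real
  assumes "t > 0"
  shows "dilation (vector [1, 1, \<gamma>]) t ` arctan_graph c = arctan_graph (t powr \<gamma> * c)"
proof (rule set_eqI)
  fix x :: "real^3"
  define s where "s = inverse t"
  have s: "s > 0" using assms by (simp add: s_def)
  have "s powr \<gamma> * t powr \<gamma> = 1" using assms by (simp add: s_def flip: powr_mult)
  then have "s powr \<gamma> * a = b \<longleftrightarrow> a = t powr \<gamma> * b" for a b
    by (metis mult.assoc mult.commute mult_1)
  then show "x \<in> dilation (vector [1, 1, \<gamma>]) t ` arctan_graph c \<longleftrightarrow> x \<in> arctan_graph (t powr \<gamma> * c)"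
    unfolding mem_dilation_image_iff[OF assms] s_def[symmetric]
    using s by (simp add: arctan_graph_def dilation_def zero_less_mult_iff mult.assoc)
qed

section \<open>The quadratic cone\<close>

text \<open>The constant Hessian of \<open>quadric_form\<close>; as the form is homogeneous
  quadratic, it also maps \<open>x\<close> to the gradient at \<open>x\<close>.\<close>

definition antidiag :: "real^4 \<Rightarrow> real^4" where
  "antidiag x = vector [x $ 4, x $ 3, x $ 2, x $ 1]"

lemma antidiag_antidiag [simp]: "antidiag (antidiag x) = x"
  by (simp add: antidiag_def vec_eq_iff forall_4)

lemma antidiag_eq_0_iff [simp]: "antidiag x = 0 \<longleftrightarrow> x = 0"
  by (auto simp: antidiag_def vec_eq_iff forall_4)

lemma gderiv_quadric_form: "GDERIV quadric_form x :> antidiag x"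
  unfolding gderiv_def quadric_form_def[abs_def]
  by (auto intro!: derivative_eq_intros simp: fun_eq_iff inner_4 antidiag_def)

text \<open>Gradients are unique, and \<open>antidiag x\<close> vanishes only at the origin.\<close>

lemma regular_part_quadric_form: "regular_part quadric_form = quadric_cone - {0}"
proof -
  have "G = antidiag x" if "GDERIV quadric_form x :> G" for x G
  proof -
    have "(\<lambda>h. h \<bullet> G) = (\<lambda>h. h \<bullet> antidiag x)"
      using that gderiv_quadric_form unfolding gderiv_def by (rule has_derivative_unique)
    then show ?thesis by (metis vector_eq_ldot)
  qed
  then show ?thesis
    using gderiv_quadric_form by (fastforce simp: regular_part_def quadric_cone_def)
qed

lemma cone_level_set: "level_set (quadric_cone - {0}) (- {0}) quadric_form antidiag (\<lambda>_. antidiag)"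
proof
  fix x
  show "(antidiag has_derivative antidiag) (at x)"
  proof (rule has_derivative_vec_componentwise)
    fix i :: 4
    show "((\<lambda>x. antidiag x $ i) has_derivative (\<lambda>h. antidiag h $ i)) (at x)"
      using exhaust_4[of i] by (elim disjE) (auto simp: antidiag_def intro!: derivative_eq_intros)
  qed
qed (auto simp: quadric_cone_def gderiv_quadric_form)

lemma C2_hypersurface_cone: "C2_hypersurface (quadric_cone - {0})"
  by (rule level_set.C2_hypersurface_level_set[OF cone_level_set]) auto

lemma minimal_cone: "minimal_hypersurface (quadric_cone - {0})"
proof -
  have "mean_curvature_vector (quadric_cone - {0}) p = 0" if "p \<in> quadric_cone - {0}" for p
  proof -
    have "(\<Sum>b\<in>Basis. antidiag b \<bullet> b) = 0"
      by (simp add: sum_Basis_vec sum_4 inner_4 antidiag_def axis_def)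
    \<comment> \<open>By the involution property this is the normal Hessian entry at the gradient;
      it equals \<open>2 * quadric_form p\<close>.\<close>
    moreover have "p \<bullet> antidiag p = 0"
      using that by (simp add: quadric_cone_def quadric_form_def inner_4 antidiag_def algebra_simps)
    ultimately show ?thesis
      using level_set.mean_curvature_vector_eq[OF cone_level_set, of p] that by simp
  qed
  then show ?thesis by (simp add: minimal_hypersurface_def C2_hypersurface_cone)
qed

lemma nonflat_cone: "nonflat_hypersurface (quadric_cone - {0})"
proof -
  interpret level_set "quadric_cone - {0}" "- {0}" quadric_form antidiag "\<lambda>_. antidiag"
    by (rule cone_level_set)
  \<comment> \<open>The gradient at the first axis vector is the fourth, so the second and third are
    tangent there, and \<open>antidiag\<close> exchanges these two.\<close>
  define p u v :: "real^4" where "p = axis 1 1" and "u = axis 2 1" and "v = axis 3 1"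
  have p: "p \<in> quadric_cone - {0}" "p \<in> - {0}"
    by (simp_all add: p_def quadric_cone_def quadric_form_def axis_eq_0_iff) (simp_all add: axis_def)
  have uv: "u \<in> tangent_space (quadric_cone - {0}) p" "v \<in> tangent_space (quadric_cone - {0}) p"
    using p by (simp_all add: tangent_space_eq inner_4 antidiag_def) (simp_all add: p_def u_def v_def axis_def)
  have "antidiag u \<bullet> v \<noteq> 0"
    by (simp add: inner_4 antidiag_def u_def v_def) (simp add: axis_def)
  then have "second_fundamental_form (quadric_cone - {0}) p u v \<noteq> 0"
    using p uv by (simp add: second_fundamental_form_eq)
  then show ?thesis
    using p uv unfolding nonflat_hypersurface_def by (blast intro: C2_hypersurface_cone)
qed

text \<open>Up to signs, the cone is the set of singular \<open>2 \<times> 2\<close> matrices, and those of rank one are the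
  products of a nonzero column and a nonzero row.\<close>

lemma connected_cone: "connected (quadric_cone - {0})"
proof -
  \<comment> \<open>The column is \<open>(a, b)\<close> and the row \<open>(c, d)\<close>; the sign
    in \<open>- b * c\<close> turns the vanishing determinant into
    \<open>quadric_form = 0\<close>.\<close>
  define h :: "(real \<times> real) \<times> (real \<times> real) \<Rightarrow> real^4" where
    "h = (\<lambda>((a, b), (c, d)). vector [a * c, a * d, - b * c, b * d])"
  have "connected ((- {0::real \<times> real}) \<times> (- {0::real \<times> real}))"
    by (intro connected_Times connected_punctured_universe) auto
  moreover have "continuous_on UNIV h"
  proof (rule continuous_on_vec_componentwise)
    fix i :: 4
    show "continuous_on UNIV (\<lambda>x. h x $ i)"
      using exhaust_4[of i] by (elim disjE) (auto simp: h_def case_prod_beta intro!: continuous_intros)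
  qed
  ultimately have "connected (h ` ((- {0}) \<times> (- {0})))"
    by (intro connected_continuous_image) (auto intro: continuous_on_subset)
  moreover have "h ` ((- {0}) \<times> (- {0})) = quadric_cone - {0}"
  proof (intro set_eqI iffI)
    fix x assume "x \<in> h ` ((- {0}) \<times> (- {0}))"
    then show "x \<in> quadric_cone - {0}"
      by (auto simp: h_def quadric_cone_def quadric_form_def vec_eq_iff forall_4 zero_prod_def)
  next
    fix x assume "x \<in> quadric_cone - {0}"
    then have x: "x $ 1 * x $ 4 = - (x $ 2 * x $ 3)" "x \<noteq> 0"
      by (auto simp: quadric_cone_def quadric_form_def)
    \<comment> \<open>If the first matrix row \<open>(x $ 1, x $ 2)\<close> is nonzero, it serves as
      the row factor, and a nonzero entry of it determines the column. Otherwise the column is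
      \<open>(0, 1)\<close> and the row is \<open>(- x $ 3, x $ 4)\<close>.\<close>
    consider (1) "x $ 1 \<noteq> 0" | (2) "x $ 1 = 0" "x $ 2 \<noteq> 0" | (0) "x $ 1 = 0" "x $ 2 = 0"
      by blast
    then show "x \<in> h ` ((- {0}) \<times> (- {0}))"
    proof cases
      case 1
      then have "x = h ((1, - x $ 3 / x $ 1), (x $ 1, x $ 2))"
        using x by (simp add: h_def vec_eq_iff forall_4 field_simps)
      with 1 show ?thesis by (intro image_eqI) (auto simp: zero_prod_def)
    next
      case 2
      then have "x = h ((1, x $ 4 / x $ 2), (0, x $ 2))"
        using x by (simp add: h_def vec_eq_iff forall_4)
      with 2 show ?thesis by (intro image_eqI) (auto simp: zero_prod_def)
    next
      case 0
      then have "x = h ((0, 1), (- x $ 3, x $ 4))" "x $ 3 \<noteq> 0 \<or> x $ 4 \<noteq> 0"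
        using x by (auto simp: h_def vec_eq_iff forall_4)
      then show ?thesis by (intro image_eqI) (auto simp: zero_prod_def)
    qed
  qed
  ultimately show ?thesis by simp
qed

lemma dilation_cone:
  assumes "t > 0"
  shows "dilation (vector [1, 2, 3, 4]) t ` (quadric_cone - {0}) = quadric_cone - {0}"
proof (rule set_eqI)
  fix x :: "real^4"
  define s where "s = inverse t"
  have "s > 0" using assms by (simp add: s_def)
  let ?y = "dilation (vector [1, 2, 3, 4]) s x"
  \<comment> \<open>The exponent is the common pair sum 1 + 4 = 2 + 3.\<close>
  have "quadric_form ?y = s powr 5 * quadric_form x"
    using \<open>s > 0\<close> by (simp add: quadric_form_def dilation_def algebra_simps eval_nat_numeral)
  moreover have "?y = 0 \<longleftrightarrow> x = 0"
    using \<open>s > 0\<close> by (simp add: dilation_def vec_eq_iff)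
  ultimately show "x \<in> dilation (vector [1, 2, 3, 4]) t ` (quadric_cone - {0}) \<longleftrightarrow> x \<in> quadric_cone - {0}"
    using assms \<open>s > 0\<close> by (simp add: mem_dilation_image_iff quadric_cone_def flip: s_def)
qed

theorem proposition3p7:
  shows
    "(\<forall>\<gamma> c :: real. \<gamma> > 0 \<and> \<gamma> \<noteq> 1 \<and> c \<noteq> 0 \<longrightarrow>
        (let g = vector [1, 1, \<gamma>] :: real^3 in
          positive_weights g \<and> pair_sum_resonant g \<and> nonuniform g \<and>
          (\<forall>t>0. helicoid_patch (dilation g t ` arctan_graph c) \<and>
                 minimal_hypersurface (dilation g t ` arctan_graph c)) \<and>
          nonflat_hypersurface (arctan_graph c)))
     \<and>
     (let g = vector [1, 2, 3, 4] :: real^4 in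
        positive_weights g \<and> pair_sum_resonant g \<and> nonuniform g \<and>
        regular_part quadric_form = quadric_cone - {0} \<and>
        connected (regular_part quadric_form) \<and>
        nonflat_hypersurface (regular_part quadric_form) \<and>
        minimal_hypersurface (regular_part quadric_form) \<and>
        (\<forall>t>0. dilation g t ` (quadric_cone - {0}) = quadric_cone - {0}))"
proof -
  \<comment> \<open>The colliding pairs are \<open>{1, 3}\<close> and \<open>{2, 3}\<close>, both
    with sum \<open>1 + \<gamma>\<close>.\<close>
  have res3: "pair_sum_resonant (vector [1, 1, \<gamma>] :: real^3)" for \<gamma> :: real
  proof (rule pair_sum_resonantI)
    show "{1, 3 :: 3} \<noteq> {2, 3}" by (auto simp: doubleton_eq_iff)
  qed auto
  have res4: "pair_sum_resonant (vector [1, 2, 3, 4] :: real^4)"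
  proof (rule pair_sum_resonantI)
    show "{1, 4 :: 4} \<noteq> {2, 3}" by (auto simp: doubleton_eq_iff)
  qed auto
  have non3: "nonuniform (vector [1, 1, \<gamma>] :: real^3)" if "\<gamma> \<noteq> 1" for \<gamma> :: real
    unfolding nonuniform_def using that by (intro exI[of _ 1] exI[of _ 3]) simp
  have non4: "nonuniform (vector [1, 2, 3, 4] :: real^4)"
    unfolding nonuniform_def by (intro exI[of _ 1] exI[of _ 2]) simp
  \<comment> \<open>Each dilated graph is again an arctan graph, with parameter
    \<open>t powr \<gamma> * c\<close>, nonzero because \<open>t > 0\<close>, so the results for a
    single graph apply.\<close>
  show ?thesis
    unfolding Let_def regular_part_quadric_form
    using res3 res4 non3 non4 helicoid_patch_arctan_graph minimal_arctan_graph nonflat_arctan_graph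
      connected_cone nonflat_cone minimal_cone dilation_cone
    by (auto simp: positive_weights_def forall_3 forall_4 dilation_arctan_graph)
qed

end
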